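(* Let $A\in\mathbb{C}^{n\times n}$ be a quasi-sectorial matrix with phase center $\gamma(A)\in\mathbb{R}$, and let $\alpha,\beta\in\mathbb{R}$ with $0\leq\beta-\alpha<2\pi$. Then $\det(I+AB)\neq0$ for all $B\in\mathcal{C}[\alpha,\beta]$ if and only if $[\alpha,\beta]\subset(-\pi-\underline{\phi}(A),\,\pi-\overline{\phi}(A))$ modulo $2\pi$, i.e. there is an integer $k$ such that $[\alpha+2\pi k,\beta+2\pi k]\subset(-\pi-\underline{\phi}(A),\,\pi-\overline{\phi}(A))$.
   Context: For $C\in\mathbb{C}^{n\times n}$, the numerical range is $W(C)=\{x^*Cx:\|x\|=1\}$ and the angular numerical range is $W'(C)=\{x^*Cx:x\in\mathbb{C}^n,x\neq0\}$, a convex cone. The field angle $\delta(C)$ is the angle subtended by $W'(C)$ if $W'(C)$ contains no line through the origin, $\pi$ if it contains exactly one line through the origin, and $2\pi$ if it is all of $\mathbb{C}$. $C$ is sectorial if $0\notin W(C)$, quasi-sectorial if $\delta(C)<\pi$, and semi-sectorial if $\delta(C)\leq\pi$. The zero matrix is quasi-sectorial, has no phases, and by convention $\overline{\phi}(0)=-\infty$, $\underline{\phi}(0)=\infty$. Phases. A sectorial $C$ can be written $C=T^*DT$ with $T$ nonsingular and $D$ diagonal unitary, the diagonal entries of $D$ being unique up to permutation and lying in an arc of length less than $\pi$; the phases $\overline{\phi}(C)=\phi_1(C)\geq\dots\geq\phi_n(C)=\underline{\phi}(C)$ are the arguments of the diagonal entries of $D$, selected so that $\overline{\phi}(C)-\underline{\phi}(C)<\pi$.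 A quasi-sectorial $C$ of rank $r$ has a decomposition $C=U\begin{bmatrix}0&0\\0&C_s\end{bmatrix}U^*$ with $U$ unitary and $C_s\in\mathbb{C}^{r\times r}$ sectorial; its $r$ phases are those of $C_s$. A semi-sectorial $C$ of rank $r$ with $\delta(C)=\pi$ is of one of two kinds. (i) Rotated Hermitian: $W(C)$ is a straight segment with the origin in its relative interior, $C=T^*\mathrm{diag}\{0_{n-r},e^{j(\theta_0+\pi/2)}I,e^{j(\theta_0-\pi/2)}I\}T$ with $T$ nonsingular, and its phases are the corresponding copies of $\theta_0+\pi/2$ and $\theta_0-\pi/2$. (ii) Otherwise $C=T^*\,\mathrm{diag}\{0_{n-r},D,E\}\,T$ with $T$ nonsingular, $D=\mathrm{diag}\{e^{j\theta_1},\dots,e^{j\theta_m}\}$, $\theta_0+\pi/2\geq\theta_1\geq\cdots\geq\theta_m\geq\theta_0-\pi/2$, and $E$ block diagonal with $(r-m)/2$ blocks $e^{j\theta_0}\begin{bmatrix}1&2\\0&1\end{bmatrix}$; its phases are $\theta_1,\dots,\theta_m$ together with $(r-m)/2$ copies of each of $\theta_0+\pi/2$ and $\theta_0-\pi/2$. The largest and smallest phases are denoted $\overline{\phi}(C),\underline{\phi}(C)$. The phase center is $\gamma(C)=[\overline{\phi}(C)+\underline{\phi}(C)]/2$ ($=\theta_0$ when $\delta(C)=\pi$). Phases are determined only up to the choice of the phase center (modulo $2\pi$; modulo $\pi$ in the rotated Hermitian case); fixing $\gamma(C)\in\mathbb{R}$ fixes the phases. For $0\leq\beta-\alpha<2\pi$,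 $\mathcal{C}[\alpha,\beta]$ is the set of all semi-sectorial $C\in\mathbb{C}^{n\times n}$ with $[\underline{\phi}(C),\overline{\phi}(C)]\subset[\alpha,\beta]$ (for some admissible selection of the phases of $C$); it contains the zero matrix. *)

theory Defs
  imports
    Jordan_Normal_Form.Schur_Decomposition
    Jordan_Normal_Form.Determinant
    "HOL-Analysis.Line_Segment"
    "HOL-Library.Extended_Real"
begin

section \<open>Numerical ranges and the field angle\<close>

text \<open>Since \<open>v \<bullet>c w\<close> conjugates its second argument, \<open>(C *\<^sub>v x) \<bullet>c x\<close> is the
  quadratic form \<open>x\<^sup>* C x\<close>, and \<open>x \<bullet>c x\<close> is the squared Euclidean norm of \<open>x\<close>.\<close>

definition numerical_range :: "complex mat \<Rightarrow> complex set" where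
  "numerical_range C =
    {(C *\<^sub>v x) \<bullet>c x | x. x \<in> carrier_vec (dim_row C) \<and> x \<bullet>c x = 1}"

definition angular_numerical_range :: "complex mat \<Rightarrow> complex set" where
  "angular_numerical_range C =
    {(C *\<^sub>v x) \<bullet>c x | x. x \<in> carrier_vec (dim_row C) \<and> x \<noteq> 0\<^sub>v (dim_row C)}"

definition line_through_origin :: "complex set \<Rightarrow> bool" where
  "line_through_origin L \<longleftrightarrow> (\<exists>z. z \<noteq> 0 \<and> L = range (\<lambda>t::real. of_real t * z))"

definition closed_sector :: "real \<Rightarrow> real \<Rightarrow> complex set" where
  "closed_sector a b = {of_real r * cis t | r t. 0 \<le> r \<and> a \<le> t \<and> t \<le> b}"

text \<open>The angle of a cone is the infimum of the openings of the closed sectors containing it;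
  cones that are not closed (e.g. an open half-plane together with the origin) have the angle
  of their closure, and the cone \<open>{0}\<close> has angle 0.\<close>

definition subtended_angle :: "complex set \<Rightarrow> real" where
  "subtended_angle K = Inf {b - a | a b. a \<le> b \<and> K \<subseteq> closed_sector a b}"

text \<open>The angular numerical range is a convex cone, so it is the whole plane as soon as it
  contains two different lines through the origin; this is the last case.\<close>

definition field_angle :: "complex mat \<Rightarrow> real" where
  "field_angle C =
    (let W = angular_numerical_range C in
     if \<nexists>L. line_through_origin L \<and> L \<subseteq> W then subtended_angle W
     else if \<exists>!L. line_through_origin L \<and> L \<subseteq> W then pi
     else 2 * pi)"

definition sectorial :: "complex mat \<Rightarrow> bool" where
  "sectorial C \<longleftrightarrow> 0 \<notin> numerical_range C"

definition quasi_sectorial :: "complex mat \<Rightarrow> bool" where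
  "quasi_sectorial C \<longleftrightarrow> field_angle C < pi"

definition semi_sectorial :: "complex mat \<Rightarrow> bool" where
  "semi_sectorial C \<longleftrightarrow> field_angle C \<le> pi"

section \<open>Phases\<close>

text \<open>Phases are not unique: they may be shifted by multiples of \<open>2\<pi>\<close> (of \<open>\<pi>\<close> for rotated
  Hermitian matrices). The predicates below therefore say that a nonincreasing list is one
  admissible selection of the phases, counted with multiplicity.\<close>

definition unitary_mat :: "complex mat \<Rightarrow> bool" where
  "unitary_mat U \<longleftrightarrow> square_mat U \<and> mat_adjoint U * U = 1\<^sub>m (dim_row U)"

definition congruent_mat :: "complex mat \<Rightarrow> complex mat \<Rightarrow> bool" where
  "congruent_mat C M \<longleftrightarrow>
    (\<exists>T \<in> carrier_mat (dim_row C) (dim_row C). invertible_mat T \<and> C = mat_adjoint T * M * T)"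

definition cis_diag :: "real list \<Rightarrow> complex mat" where
  "cis_diag ts = mat_diag (length ts) (\<lambda>i. cis (ts ! i))"

definition sectorial_phases :: "complex mat \<Rightarrow> real list \<Rightarrow> bool" where
  "sectorial_phases C ts \<longleftrightarrow>
    sectorial C \<and> length ts = dim_row C \<and> congruent_mat C (cis_diag ts) \<and>
    sorted_wrt (\<ge>) ts \<and> (\<forall>s \<in> set ts. \<forall>t \<in> set ts. s - t < pi)"

text \<open>In this and the following decompositions the size of the nonzero part is necessarily the
  rank of \<open>C\<close>, since the zero block is complemented by a nonsingular one.\<close>

definition quasi_sectorial_phases :: "complex mat \<Rightarrow> real list \<Rightarrow> bool" where
  "quasi_sectorial_phases C ts \<longleftrightarrow>
    (\<exists>r U Cs. r \<le> dim_row C \<and> U \<in> carrier_mat (dim_row C) (dim_row C) \<and> unitary_mat U \<and>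
       Cs \<in> carrier_mat r r \<and>
       C = U * four_block_mat (0\<^sub>m (dim_row C - r) (dim_row C - r)) (0\<^sub>m (dim_row C - r) r)
                              (0\<^sub>m r (dim_row C - r)) Cs
             * mat_adjoint U \<and>
       sectorial_phases Cs ts)"

definition rotated_hermitian :: "complex mat \<Rightarrow> bool" where
  "rotated_hermitian C \<longleftrightarrow>
    (\<exists>a b. numerical_range C = closed_segment a b \<and> 0 \<in> open_segment a b)"

definition rotated_hermitian_phases :: "complex mat \<Rightarrow> real list \<Rightarrow> bool" where
  "rotated_hermitian_phases C ts \<longleftrightarrow>
    (\<exists>\<theta>0 p q. p + q \<le> dim_row C \<and>
       ts = replicate p (\<theta>0 + pi / 2) @ replicate q (\<theta>0 - pi / 2) \<and>
       congruent_mat C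
         (diag_block_mat [0\<^sub>m (dim_row C - (p + q)) (dim_row C - (p + q)), cis_diag ts]))"

definition phase_E_block :: "real \<Rightarrow> complex mat" where
  "phase_E_block \<theta>0 = cis \<theta>0 \<cdot>\<^sub>m mat_of_rows_list 2 [[1, 2], [0, 1]]"

text \<open>Here \<open>ds\<close> lists the angles of \<open>D\<close> and \<open>k\<close> is the number of blocks of \<open>E\<close>.\<close>

definition half_plane_phases :: "complex mat \<Rightarrow> real list \<Rightarrow> bool" where
  "half_plane_phases C ts \<longleftrightarrow>
    (\<exists>\<theta>0 ds k. length ds + 2 * k \<le> dim_row C \<and>
       sorted_wrt (\<ge>) ds \<and> set ds \<subseteq> {\<theta>0 - pi / 2 .. \<theta>0 + pi / 2} \<and>
       ts = replicate k (\<theta>0 + pi / 2) @ ds @ replicate k (\<theta>0 - pi / 2) \<and>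
       congruent_mat C
         (diag_block_mat
           [0\<^sub>m (dim_row C - (length ds + 2 * k)) (dim_row C - (length ds + 2 * k)),
            cis_diag ds,
            diag_block_mat (replicate k (phase_E_block \<theta>0))]))"

definition has_phases :: "complex mat \<Rightarrow> real list \<Rightarrow> bool" where
  "has_phases C ts \<longleftrightarrow>
    field_angle C < pi \<and> quasi_sectorial_phases C ts \<or>
    field_angle C = pi \<and> rotated_hermitian C \<and> rotated_hermitian_phases C ts \<or>
    field_angle C = pi \<and> \<not> rotated_hermitian C \<and> half_plane_phases C ts"

text \<open>With values in the extended reals, the empty list (the phases of the zero matrix) gets
  largest phase \<open>-\<infinity>\<close> and smallest phase \<open>\<infinity>\<close>.\<close>

definition max_phase :: "real list \<Rightarrow> ereal" where
  "max_phase ts = Sup (ereal ` set ts)"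

definition min_phase :: "real list \<Rightarrow> ereal" where
  "min_phase ts = Inf (ereal ` set ts)"

text \<open>\<open>ts\<close> are the phases of \<open>C\<close> for the choice \<open>\<gamma>\<close> of the phase center; the zero matrix has no
  phases, and its phase center is unconstrained.\<close>

definition has_phases_with_center :: "complex mat \<Rightarrow> real \<Rightarrow> real list \<Rightarrow> bool" where
  "has_phases_with_center C \<gamma> ts \<longleftrightarrow>
    has_phases C ts \<and> (ts \<noteq> [] \<longrightarrow> ereal \<gamma> = (max_phase ts + min_phase ts) / 2)"

definition phase_class :: "nat \<Rightarrow> real \<Rightarrow> real \<Rightarrow> complex mat set" where
  "phase_class n \<alpha> \<beta> =
    {C \<in> carrier_mat n n. semi_sectorial C \<and>
       (\<exists>ts. has_phases C ts \<and> {min_phase ts .. max_phase ts} \<subseteq> {ereal \<alpha> .. ereal \<beta>})}"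

end

theory Submission
  imports Defs
begin

text \<open>If \<open>(I + AB)x = 0\<close> with \<open>x \<noteq> 0\<close> and \<open>y = Bx\<close>, then \<open>Ay = -x\<close>, so \<open>y\<^sup>*Ay\<close> is minus the
  conjugate of \<open>x\<^sup>*Bx\<close>, and it is nonzero because the quadratic form of a quasi-sectorial matrix
  vanishes only on its kernel. The two numbers lie in the cones spanned by the phases of \<open>A\<close> and of
  \<open>B\<close>, so a number between two phases of \<open>A\<close> and one between two phases of \<open>B\<close> add up to \<open>\<pi>\<close>
  modulo \<open>2\<pi>\<close>. Conversely, if the interval condition fails, then \<open>s + t \<equiv> \<pi>\<close> modulo \<open>2\<pi>\<close> for
  some \<open>t \<in> [\<alpha>, \<beta>]\<close> and some \<open>s\<close> between the extreme phases of \<open>A\<close>. There is a unit vector \<open>u\<close>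
  with \<open>u\<^sup>*Au = \<rho>e\<^sup>i\<^sup>s\<close>, \<open>\<rho> > 0\<close>, and the rank-one matrix \<open>B = \<rho>\<^sup>-\<^sup>1e\<^sup>i\<^sup>tuu\<^sup>*\<close>, whose only phase is
  \<open>t\<close>, satisfies \<open>BAu = -u\<close>.\<close>

unbundle no vec_syntax

section \<open>Quadratic forms\<close>

definition quad_form :: "complex mat \<Rightarrow> complex Matrix.vec \<Rightarrow> complex" where
  "quad_form M x = (M *\<^sub>v x) \<bullet>c x"

definition form_in :: "complex mat \<Rightarrow> complex set \<Rightarrow> bool" where
  "form_in M S \<longleftrightarrow> (\<forall>x \<in> carrier_vec (dim_row M). quad_form M x \<in> S)"

section \<open>Adjoints and congruence of quadratic forms\<close>

lemma mat_adjoint_carrier [simp]: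
  "T \<in> carrier_mat n m \<Longrightarrow> mat_adjoint T \<in> carrier_mat m n"
  by (auto simp: mat_adjoint_def mat_of_rows_def)

lemma mat_adjoint_index [simp]:
  "i < dim_col T \<Longrightarrow> j < dim_row T \<Longrightarrow> mat_adjoint T $$ (i, j) = conjugate (T $$ (j, i))"
  by (auto simp: mat_adjoint_def mat_of_rows_def)

lemma mat_adjoint_dim [simp]:
  "dim_row (mat_adjoint T) = dim_col T" "dim_col (mat_adjoint T) = dim_row T"
  by (auto simp: mat_adjoint_def)

lemma mat_adjoint_adjoint [simp]: "mat_adjoint (mat_adjoint T) = T"
  by (rule eq_matI) auto

lemma mat_adjoint_mult_vec:
  fixes T :: "complex mat"
  assumes T: "T \<in> carrier_mat n m" and x: "x \<in> carrier_vec m" and y: "y \<in> carrier_vec n"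
  shows "(mat_adjoint T *\<^sub>v y) \<bullet>c x = y \<bullet>c (T *\<^sub>v x)"
proof -
  have "(mat_adjoint T *\<^sub>v y) \<bullet>c x
      = (\<Sum>i = 0..<m. \<Sum>j = 0..<n. cnj (T $$ (j, i)) * y $ j * cnj (x $ i))"
    using assms by (auto simp: scalar_prod_def sum_distrib_right intro!: sum.cong)
  also have "\<dots> = (\<Sum>j = 0..<n. \<Sum>i = 0..<m. cnj (T $$ (j, i)) * y $ j * cnj (x $ i))"
    by (rule sum.swap)
  also have "\<dots> = y \<bullet>c (T *\<^sub>v x)"
    using assms by (auto simp: scalar_prod_def sum_distrib_left sum_distrib_right mult_ac intro!: sum.cong)
  finally show ?thesis .
qed

text \<open>The adjoint moves across the inner product. All canonical forms that define phases are
  reached through this identity, with \<open>T\<close> a congruence or the adjoint of a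
  unitary.\<close>

lemma quad_form_congruence:
  assumes T: "T \<in> carrier_mat n m" and M: "M \<in> carrier_mat n n" and x: "x \<in> carrier_vec m"
  shows "quad_form (mat_adjoint T * M * T) x = quad_form M (T *\<^sub>v x)"
proof -
  have T': "mat_adjoint T \<in> carrier_mat m n" using T by simp
  have "mat_adjoint T * M * T *\<^sub>v x = mat_adjoint T * M *\<^sub>v (T *\<^sub>v x)"
    by (rule assoc_mult_mat_vec[OF mult_carrier_mat[OF T' M] T x])
  also have "\<dots> = mat_adjoint T *\<^sub>v (M *\<^sub>v (T *\<^sub>v x))"
    by (rule assoc_mult_mat_vec[OF T' M]) (use T x in auto)
  finally show ?thesis
    using mat_adjoint_mult_vec[OF T x, of "M *\<^sub>v (T *\<^sub>v x)"] T M x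
    by (auto simp: quad_form_def)
qed

text \<open>The value of the form of \<open>C\<close> at \<open>x\<close> is that of
  \<open>M\<close> at \<open>T x\<close>, so locating the form of the canonical matrix locates that
  of \<open>C\<close>.\<close>

lemma form_in_congruent_mat:
  assumes "congruent_mat C M" "M \<in> carrier_mat (dim_row C) (dim_row C)" "form_in M S"
  shows "form_in C S"
proof -
  obtain T where T: "T \<in> carrier_mat (dim_row C) (dim_row C)" and C: "C = mat_adjoint T * M * T"
    using assms(1) unfolding congruent_mat_def by blast
  show ?thesis
    unfolding form_in_def
  proof
    fix x :: "complex Matrix.vec" assume x: "x \<in> carrier_vec (dim_row C)"
    have "quad_form C x = quad_form M (T *\<^sub>v x)"
      using quad_form_congruence[OF T assms(2) x] C by simp
    moreover have "T *\<^sub>v x \<in> carrier_vec (dim_row M)"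
      using T x assms(2) by auto
    ultimately show "quad_form C x \<in> S"
      using assms(3) unfolding form_in_def by simp
  qed
qed

section \<open>Forms of block diagonal matrices\<close>

lemma quad_form_four_block_diag:
  assumes "A \<in> carrier_mat n n" "D \<in> carrier_mat m m" "v \<in> carrier_vec n" "w \<in> carrier_vec m"
  shows "quad_form (four_block_mat A (0\<^sub>m n m) (0\<^sub>m m n) D) (v @\<^sub>v w) = quad_form A v + quad_form D w"
proof -
  have "conjugate (v @\<^sub>v w) = conjugate v @\<^sub>v conjugate w"
    by (rule eq_vecI) auto
  then show ?thesis
    unfolding quad_form_def mult_mat_vec_split[OF assms]
    using assms by (auto intro!: scalar_prod_append[of _ n _ m])
qed

text \<open>This is what sums over diagonal blocks require: 0 for a vanishing block or an empty sum,
  and closure for adding two contributions.\<close>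

definition additive_cone :: "complex set \<Rightarrow> bool" where
  "additive_cone S \<longleftrightarrow> 0 \<in> S \<and> (\<forall>z \<in> S. \<forall>w \<in> S. z + w \<in> S)"

lemma additive_cone_sum:
  "additive_cone S \<Longrightarrow> (\<And>i. i \<in> I \<Longrightarrow> f i \<in> S) \<Longrightarrow> sum f I \<in> S"
  by (induction I rule: infinite_finite_induct) (auto simp: additive_cone_def)

lemma form_in_zero_mat: "0 \<in> S \<Longrightarrow> form_in (0\<^sub>m n n) S"
  by (auto simp: form_in_def quad_form_def scalar_prod_def)

lemma form_in_four_block_diag:
  assumes "additive_cone S" "A \<in> carrier_mat n n" "D \<in> carrier_mat m m"
    and "form_in A S" "form_in D S"
  shows "form_in (four_block_mat A (0\<^sub>m n m) (0\<^sub>m m n) D) S"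
  unfolding form_in_def
proof
  fix x :: "complex Matrix.vec" assume "x \<in> carrier_vec (dim_row (four_block_mat A (0\<^sub>m n m) (0\<^sub>m m n) D))"
  then have "x \<in> carrier_vec (n + m)" using assms by simp
  then have x: "vec_first x n @\<^sub>v vec_last x m = x" by simp
  have "quad_form A (vec_first x n) \<in> S" "quad_form D (vec_last x m) \<in> S"
    using assms by (auto simp: form_in_def)
  then show "quad_form (four_block_mat A (0\<^sub>m n m) (0\<^sub>m m n) D) x \<in> S"
    using quad_form_four_block_diag[OF assms(2,3), of "vec_first x n" "vec_last x m"] assms(1)
    unfolding x by (auto simp: additive_cone_def)
qed

lemma form_in_diag_block_mat:
  assumes "additive_cone S" "\<And>M. M \<in> set Ms \<Longrightarrow> square_mat M \<and> form_in M S"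
  shows "form_in (diag_block_mat Ms) S"
  using assms(2)
proof (induction Ms)
  case Nil
  then show ?case using assms(1) by (simp add: form_in_zero_mat additive_cone_def)
next
  case (Cons M Ms)
  have sq: "square_mat (diag_block_mat Ms)"
    using Cons.prems by (intro diag_block_mat_square) auto
  \<comment> \<open>Squareness gives the off-diagonal zero blocks of \<open>diag_block_mat\<close>
    the shapes used in the two-block lemma.\<close>
  then have "dim_col M = dim_row M" "dim_col (diag_block_mat Ms) = dim_row (diag_block_mat Ms)"
    using Cons.prems by auto
  moreover have "form_in (four_block_mat M (0\<^sub>m (dim_row M) (dim_row (diag_block_mat Ms)))
      (0\<^sub>m (dim_row (diag_block_mat Ms)) (dim_row M)) (diag_block_mat Ms)) S"
    using Cons calculation by (intro form_in_four_block_diag[OF assms(1)]) auto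
  ultimately show ?case by (simp add: Let_def)
qed

lemma quad_form_mat_diag:
  assumes "x \<in> carrier_vec n"
  shows "quad_form (mat_diag n f) x = (\<Sum>i<n. of_real ((cmod (x $ i))\<^sup>2) * f i)"
proof -
  have "(mat_diag n f *\<^sub>v x) $ i = f i * x $ i" if "i < n" for i
  proof -
    have "(mat_diag n f *\<^sub>v x) $ i = (\<Sum>j = 0..<n. (if i = j then f j else 0) * x $ j)"
      using that assms by (auto simp: mat_diag_def scalar_prod_def intro!: sum.cong)
    also have "\<dots> = (\<Sum>j = 0..<n. if i = j then f j * x $ j else 0)"
      by (rule sum.cong) auto
    finally show ?thesis using that by simp
  qed
  then have "quad_form (mat_diag n f) x = (\<Sum>i = 0..<n. f i * x $ i * cnj (x $ i))"
    using assms by (auto simp: quad_form_def scalar_prod_def intro!: sum.cong)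
  also have "\<dots> = (\<Sum>i<n. of_real ((cmod (x $ i))\<^sup>2) * f i)"
    by (rule sum.cong) (auto simp: complex_norm_square simp del: of_real_power)
  finally show ?thesis .
qed

section \<open>Cones of phases\<close>

text \<open>The point 0 is added for the sake of the empty list, the phases of the zero matrix.\<close>

definition phase_cone :: "real list \<Rightarrow> complex set" where
  "phase_cone ts =
    insert 0 {of_real r * cis t | r t. 0 \<le> r \<and> (\<exists>a \<in> set ts. \<exists>b \<in> set ts. a \<le> t \<and> t \<le> b)}"

lemma phase_coneI:
  "0 \<le> r \<Longrightarrow> a \<in> set ts \<Longrightarrow> b \<in> set ts \<Longrightarrow> a \<le> t \<Longrightarrow> t \<le> b \<Longrightarrow> of_real r * cis t \<in> phase_cone ts"
  unfolding phase_cone_def by blast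

text \<open>After division by \<open>cis s\<close> the sum is \<open>z = p + q * cis d\<close> with
  \<open>0 \<le> d \<le> pi\<close>. Both \<open>Im z \<ge> 0\<close> and
  \<open>Im (z * cis (- d)) \<le> 0\<close> hold, and these two signs confine \<open>Arg z\<close>
  to the interval from 0 to \<open>d\<close>.\<close>

lemma polar_sum_between:
  assumes "0 \<le> p" "0 \<le> q" "s \<le> t" "t \<le> s + pi"
  obtains r u where "0 \<le> r" "s \<le> u" "u \<le> t" "of_real p * cis s + of_real q * cis t = of_real r * cis u"
proof -
  define d where "d = t - s"
  define z where "z = of_real p + of_real q * cis d"
  have d: "0 \<le> d" "d \<le> pi" using assms by (auto simp: d_def)
  have eq: "of_real p * cis s + of_real q * cis t = z * cis s"
    by (simp add: z_def d_def algebra_simps cis_mult)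
  have z_polar: "z = of_real (cmod z) * cis (Arg z)"
    using rcis_cmod_Arg[of z] by (simp add: rcis_def)
  have "sin d \<ge> 0" using d by (simp add: sin_ge_zero)
  have "0 \<le> q * sin d" using assms \<open>sin d \<ge> 0\<close> by simp
  also have "\<dots> = Im z" by (simp add: z_def)
  also have "\<dots> = cmod z * sin (Arg z)" by (subst z_polar) simp
  finally have low: "0 \<le> cmod z * sin (Arg z)" .
  have "z * cis (- d) = of_real (cmod z) * cis (Arg z - d)"
    by (subst z_polar) (simp add: cis_mult mult.assoc)
  then have "cmod z * sin (Arg z - d) = Im (z * cis (- d))"
    by simp
  also have "\<dots> = - (p * sin d)"
    by (simp add: z_def algebra_simps cis_mult)
  also have "\<dots> \<le> 0" using assms \<open>sin d \<ge> 0\<close> by simp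
  finally have high: "cmod z * sin (Arg z - d) \<le> 0" .
  show thesis
  proof (cases "z = 0")
    case True
    then show thesis using that[of 0 s] eq assms by simp
  next
    case False
    then have pos: "cmod z > 0" by simp
    have arg: "- pi < Arg z" "Arg z \<le> pi" by (auto simp: Arg_bounded)
    have "0 \<le> sin (Arg z)" using low pos by (simp add: zero_le_mult_iff)
    then have arg0: "0 \<le> Arg z"
      using sin_gt_zero[of "- Arg z"] arg by (cases "0 \<le> Arg z") auto
    have "Arg z \<le> d"
    proof (rule ccontr)
      assume gt: "\<not> Arg z \<le> d"
      have "sin (Arg z - d) \<le> 0" using high pos by (simp add: mult_le_0_iff)
      then have "\<not> Arg z - d < pi" using gt sin_gt_zero[of "Arg z - d"] by linarith
      \<comment> \<open>The signs of the sines leave only this boundary case, where \<open>z\<close>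
        would be both the nonnegative number \<open>p + q\<close> and a negative one.\<close>
      then have "Arg z = pi" "d = 0" using d arg by linarith+
      then have "of_real (p + q) = - complex_of_real (cmod z)"
        using z_polar[symmetric] by (simp add: z_def)
      then have "p + q = - cmod z"
        unfolding of_real_minus[symmetric] of_real_eq_iff .
      then show False using assms pos by simp
    qed
    moreover have "z * cis s = of_real (cmod z) * cis (s + Arg z)"
      by (subst z_polar) (simp add: cis_mult mult.assoc add.commute)
    ultimately show thesis
      using that[of "cmod z" "s + Arg z"] eq arg0 by (simp add: d_def)
  qed
qed

text \<open>For two points with angles \<open>u \<le> v\<close>, the lower list entry bounding
  \<open>u\<close> and the upper one bounding \<open>v\<close> differ by at most \<open>pi\<close>.
  The angle of the sum lies between \<open>u\<close> and \<open>v\<close>, hence between these two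
  entries.\<close>

lemma additive_cone_phase_cone:
  assumes "\<And>s t. s \<in> set ts \<Longrightarrow> t \<in> set ts \<Longrightarrow> s - t \<le> pi"
  shows "additive_cone (phase_cone ts)"
proof -
  have ordered: "of_real p * cis u + of_real q * cis v \<in> phase_cone ts"
    if pq: "0 \<le> p" "0 \<le> q" "u \<le> v" "a \<in> set ts" "b \<in> set ts" "a \<le> u" "v \<le> b" for p q u v a b
  proof -
    have "v \<le> u + pi" using assms[OF pq(5,4)] pq by linarith
    then obtain r t where "0 \<le> r" "u \<le> t" "t \<le> v"
      "of_real p * cis u + of_real q * cis v = of_real r * cis t"
      by (rule polar_sum_between[OF pq(1-3)])
    moreover have "a \<le> t" "t \<le> b" using calculation pq by linarith+
    ultimately show ?thesis using phase_coneI[OF _ pq(4,5)] by simp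
  qed
  have "z + w \<in> phase_cone ts" if zw: "z \<in> phase_cone ts" "w \<in> phase_cone ts" for z w
  proof (cases "z = 0 \<or> w = 0")
    case True
    then show ?thesis using zw by auto
  next
    case False
    then obtain p u a b where z: "z = of_real p * cis u" "0 \<le> p" "a \<in> set ts" "b \<in> set ts" "a \<le> u" "u \<le> b"
      using zw unfolding phase_cone_def by auto
    obtain q v c d where w: "w = of_real q * cis v" "0 \<le> q" "c \<in> set ts" "d \<in> set ts" "c \<le> v" "v \<le> d"
      using False zw unfolding phase_cone_def by auto
    show ?thesis
    proof (cases "u \<le> v")
      case True
      then show ?thesis using ordered[of p q u v a d] z w by simp
    next
      case False
      then show ?thesis using ordered[of q p v u c b] z w by (simp add: add.commute)
    qed
  qed
  then show ?thesis by (simp add: additive_cone_def phase_cone_def)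
qed

text \<open>The form is a nonnegative combination of the unit numbers on the diagonal. A separate
  list \<open>ds\<close> is allowed because in the half-plane decomposition the diagonal part may
  carry only some of the phases.\<close>

lemma form_in_cis_diag:
  assumes "additive_cone (phase_cone ts)" "set ds \<subseteq> set ts"
  shows "form_in (cis_diag ds) (phase_cone ts)"
  unfolding form_in_def
proof
  fix x :: "complex Matrix.vec" assume "x \<in> carrier_vec (dim_row (cis_diag ds))"
  then have x: "x \<in> carrier_vec (length ds)" by (simp add: cis_diag_def mat_diag_def)
  have "of_real ((cmod (x $ i))\<^sup>2) * cis (ds ! i) \<in> phase_cone ts" if "i < length ds" for i
  proof -
    have "ds ! i \<in> set ts" using that assms(2) by force
    then show ?thesis by (intro phase_coneI) auto
  qed
  then show "quad_form (cis_diag ds) x \<in> phase_cone ts"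
    unfolding cis_diag_def quad_form_mat_diag[OF x]
    by (intro additive_cone_sum[OF assms(1)]) auto
qed

text \<open>The Hermitian part of the block with rows \<open>1, 2\<close> and \<open>0, 1\<close> is
  the positive semidefinite all-ones matrix. So its form \<open>w\<close> has real part
  \<open>|x_0 + x_1|^2 \<ge> 0\<close> and stays in the closed right half-plane, which
  \<open>cis \<theta>\<close> then rotates.\<close>

lemma form_in_phase_E_block:
  assumes "\<theta> - pi / 2 \<in> set ts" "\<theta> + pi / 2 \<in> set ts"
  shows "form_in (phase_E_block \<theta>) (phase_cone ts)"
  unfolding form_in_def
proof
  fix x :: "complex Matrix.vec" assume "x \<in> carrier_vec (dim_row (phase_E_block \<theta>))"
  then have x: "x \<in> carrier_vec 2" by (simp add: phase_E_block_def mat_of_rows_list_def numeral_2_eq_2)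
  define w where "w = x $ 0 * cnj (x $ 0) + 2 * x $ 1 * cnj (x $ 0) + x $ 1 * cnj (x $ 1)"
  have "quad_form (phase_E_block \<theta>) x = cis \<theta> * w"
    using x carrier_vecD[OF x] by (simp add: quad_form_def phase_E_block_def mat_of_rows_list_def scalar_prod_def
        w_def algebra_simps numeral_2_eq_2)
  moreover have "Re w = (cmod (x $ 0 + x $ 1))\<^sup>2"
    unfolding cmod_power2 w_def by (simp add: power2_eq_square algebra_simps)
  then have "0 \<le> Re w" by simp
  have "\<bar>Arg w\<bar> \<le> pi / 2"
  proof (rule ccontr)
    assume gt: "\<not> \<bar>Arg w\<bar> \<le> pi / 2"
    have "\<bar>Arg w\<bar> \<le> pi" using Arg_bounded[of w] by (simp add: abs_le_iff)
    then have "0 < sin (\<bar>Arg w\<bar> - pi / 2)"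
      using gt by (intro sin_gt_zero) auto
    also have "\<dots> = - cos (Arg w)" by (simp add: sin_diff abs_if)
    finally have "cos (Arg w) < 0" by simp
    moreover have "Re w = cmod w * cos (Arg w)"
      using arg_cong[OF rcis_cmod_Arg[of w], of Re] by simp
    \<comment> \<open>The convention \<open>Arg 0 = 0\<close> excludes \<open>w = 0\<close>
      here.\<close>
    moreover have "w \<noteq> 0" using gt by (auto simp: Arg_zero)
    ultimately show False
      using \<open>0 \<le> Re w\<close> by (simp add: zero_le_mult_iff)
  qed
  moreover have "cis \<theta> * w = of_real (cmod w) * cis (\<theta> + Arg w)"
    using rcis_cmod_Arg[of w] by (simp add: rcis_def cis_mult[symmetric] mult_ac)
  ultimately show "quad_form (phase_E_block \<theta>) x \<in> phase_cone ts"
    using phase_coneI[OF _ assms, of "cmod w" "\<theta> + Arg w"] by simp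
qed


text \<open>The bound is strict by definition in the quasi-sectorial case; in the other two cases
  all phases lie within \<open>pi / 2\<close> of a common center. It is the condition that makes
  \<open>phase_cone ts\<close> closed under addition.\<close>

lemma has_phases_spread:
  assumes "has_phases C ts" "s \<in> set ts" "t \<in> set ts"
  shows "s - t \<le> pi"
proof -
  have "s - t < pi" if "quasi_sectorial_phases C ts"
    using that assms(2,3) unfolding quasi_sectorial_phases_def sectorial_phases_def by blast
  moreover have "s - t \<le> pi" if set: "set ts \<subseteq> {\<theta> - pi / 2 .. \<theta> + pi / 2}" for \<theta>
    using subsetD[OF set assms(2)] subsetD[OF set assms(3)] by simp
  moreover have "\<exists>\<theta>. set ts \<subseteq> {\<theta> - pi / 2 .. \<theta> + pi / 2}" if "rotated_hermitian_phases C ts"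
    using that unfolding rotated_hermitian_phases_def
    by (elim exE conjE, intro exI) (auto simp: set_replicate_conv_if)
  moreover have "\<exists>\<theta>. set ts \<subseteq> {\<theta> - pi / 2 .. \<theta> + pi / 2}" if "half_plane_phases C ts"
    using that unfolding half_plane_phases_def
    by (elim exE conjE, intro exI) (auto simp: set_replicate_conv_if)
  ultimately show ?thesis
    using assms(1) unfolding has_phases_def by (metis less_imp_le)
qed

text \<open>Only the decomposition is assumed, with no bound on the field angle, so that the lemma
  can serve to compute the field angle of a rank-one matrix. The unitary similarity is a congruence
  by \<open>mat_adjoint U\<close>.\<close>

lemma quasi_sectorial_phases_form_in:
  assumes "C \<in> carrier_mat n n" "quasi_sectorial_phases C ts" "additive_cone (phase_cone ts)"
  shows "form_in C (phase_cone ts)"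
proof -
  obtain r U Cs where r: "r \<le> n" and U: "U \<in> carrier_mat n n" and Cs: "Cs \<in> carrier_mat r r"
    and C: "C = U * four_block_mat (0\<^sub>m (n - r) (n - r)) (0\<^sub>m (n - r) r) (0\<^sub>m r (n - r)) Cs * mat_adjoint U"
    and ph: "sectorial_phases Cs ts"
    using assms(1,2) unfolding quasi_sectorial_phases_def by auto
  let ?F = "four_block_mat (0\<^sub>m (n - r) (n - r)) (0\<^sub>m (n - r) r) (0\<^sub>m r (n - r)) Cs"
  have "0 \<in> phase_cone ts" by (simp add: phase_cone_def)
  have D: "cis_diag ts \<in> carrier_mat r r"
    using ph Cs by (auto simp: cis_diag_def sectorial_phases_def)
  have "form_in Cs (phase_cone ts)"
    using ph Cs D by (auto simp: sectorial_phases_def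
        intro!: form_in_congruent_mat[of Cs "cis_diag ts"] form_in_cis_diag assms(3))
  then have F: "form_in ?F (phase_cone ts)"
    by (intro form_in_four_block_diag[OF assms(3) _ Cs] form_in_zero_mat[OF \<open>0 \<in> phase_cone ts\<close>]) auto
  have Fc: "?F \<in> carrier_mat n n" using Cs r by (auto intro: carrier_matI)
  show ?thesis
    unfolding form_in_def
  proof
    fix x :: "complex Matrix.vec" assume "x \<in> carrier_vec (dim_row C)"
    then have x: "x \<in> carrier_vec n" using assms(1) by simp
    have U': "mat_adjoint U \<in> carrier_mat n n" using U by simp
    have "quad_form C x = quad_form ?F (mat_adjoint U *\<^sub>v x)"
      using quad_form_congruence[OF U' Fc x] C by simp
    also have "\<dots> \<in> phase_cone ts"
      using F Fc U' x unfolding form_in_def by auto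
    finally show "quad_form C x \<in> phase_cone ts" .
  qed
qed

text \<open>In each of the three kinds the matrix is congruent to a block diagonal one, and every
  block, the zero block included, has its form in the additive cone of the phases.\<close>

lemma has_phases_form_in:
  assumes C: "C \<in> carrier_mat n n" and ph: "has_phases C ts"
  shows "form_in C (phase_cone ts)"
proof -
  have cone: "additive_cone (phase_cone ts)"
    using has_phases_spread[OF ph] by (rule additive_cone_phase_cone)
  have zero: "0 \<in> phase_cone ts" by (simp add: phase_cone_def)
  have [simp]: "dim_row (cis_diag ds) = length ds" "dim_col (cis_diag ds) = length ds" for ds
    by (simp_all add: cis_diag_def mat_diag_def)
  have [simp]: "dim_row (phase_E_block \<theta>) = 2" "dim_col (phase_E_block \<theta>) = 2" for \<theta>
    by (simp_all add: phase_E_block_def mat_of_rows_list_def)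
  have [simp]: "dim_row (diag_block_mat (replicate k (phase_E_block \<theta>))) = 2 * k"
    "dim_col (diag_block_mat (replicate k (phase_E_block \<theta>))) = 2 * k" for k \<theta>
    by (simp_all add: dim_diag_block_mat sum_list_replicate)
  consider (quasi) "quasi_sectorial_phases C ts"
    | (rot) "rotated_hermitian_phases C ts" | (half) "half_plane_phases C ts"
    using ph unfolding has_phases_def by blast
  then show ?thesis
  proof cases
    case quasi
    then show ?thesis using quasi_sectorial_phases_form_in[OF C _ cone] by simp
  next
    case rot
    then obtain m where "m = n - length ts" "length ts \<le> n"
      and cong: "congruent_mat C (diag_block_mat [0\<^sub>m m m, cis_diag ts])"
      using C unfolding rotated_hermitian_phases_def carrier_matD(1)[OF C]
      by (metis length_append length_replicate)
    then show ?thesis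
      using C by (intro form_in_congruent_mat[OF cong] form_in_diag_block_mat[OF cone] carrier_matI)
        (auto simp: form_in_zero_mat[OF zero] form_in_cis_diag[OF cone] dim_diag_block_mat simp del: diag_block_mat.simps)
  next
    case half
    then obtain \<theta> ds k m where "m = n - (length ds + 2 * k)" "length ds + 2 * k \<le> n"
      and ts: "ts = replicate k (\<theta> + pi / 2) @ ds @ replicate k (\<theta> - pi / 2)"
      and cong: "congruent_mat C (diag_block_mat [0\<^sub>m m m, cis_diag ds,
          diag_block_mat (replicate k (phase_E_block \<theta>))])"
      unfolding half_plane_phases_def carrier_matD(1)[OF C] by metis
    \<comment> \<open>A block occurs only for \<open>k > 0\<close>, and then \<open>ts\<close>
      contains both \<open>\<theta> + pi / 2\<close> and \<open>\<theta> - pi / 2\<close>.\<close>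
    have E: "form_in (diag_block_mat (replicate k (phase_E_block \<theta>))) (phase_cone ts)"
      by (rule form_in_diag_block_mat[OF cone]) (auto simp: ts intro!: form_in_phase_E_block)
    have "set ds \<subseteq> set ts" by (auto simp: ts)
    then show ?thesis
      using C E \<open>m = _\<close> \<open>_ \<le> n\<close>
      by (intro form_in_congruent_mat[OF cong] form_in_diag_block_mat[OF cone] carrier_matI)
        (auto simp: form_in_zero_mat[OF zero] form_in_cis_diag[OF cone] dim_diag_block_mat
          sum_list_replicate simp del: diag_block_mat.simps)
  qed
qed

section \<open>Quasi-sectorial matrices\<close>

lemma cscalar_square_pos:
  fixes w :: "complex Matrix.vec"
  assumes "w \<in> carrier_vec n" "w \<noteq> 0\<^sub>v n"
  obtains \<rho> :: real where "0 < \<rho>" "w \<bullet>c w = of_real \<rho>"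
proof
  have "w \<bullet>c w > 0" using conjugate_square_greater_0_vec[OF assms(1)] assms(2) by simp
  then show "0 < Re (w \<bullet>c w)" "w \<bullet>c w = of_real (Re (w \<bullet>c w))"
    by (auto simp: less_complex_def complex_eq_iff)
qed

lemma cscalar_smult:
  fixes v w :: "complex Matrix.vec"
  assumes "v \<in> carrier_vec n" "w \<in> carrier_vec n"
  shows "(a \<cdot>\<^sub>v v) \<bullet>c (b \<cdot>\<^sub>v w) = a * cnj b * (v \<bullet>c w)"
  using assms by (simp add: conjugate_smult_vec)

lemma normalize_cvec:
  fixes w :: "complex Matrix.vec"
  assumes "w \<in> carrier_vec n" "w \<noteq> 0\<^sub>v n"
  obtains c :: real where "0 < c" "(of_real c \<cdot>\<^sub>v w) \<bullet>c (of_real c \<cdot>\<^sub>v w) = 1"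
proof -
  obtain \<rho> where \<rho>: "0 < \<rho>" "w \<bullet>c w = complex_of_real \<rho>"
    using cscalar_square_pos[OF assms] .
  have "(1 / sqrt \<rho>) * (1 / sqrt \<rho>) * \<rho> = 1" using \<rho> by simp
  then have "complex_of_real (1 / sqrt \<rho>) * of_real (1 / sqrt \<rho>) * of_real \<rho> = 1"
    by (metis of_real_1 of_real_mult)
  then show thesis
    using that[of "1 / sqrt \<rho>"] \<rho> by (simp only: cscalar_smult[OF assms(1,1)] complex_cnj_complex_of_real) simp
qed

lemma quad_form_smult:
  assumes "M \<in> carrier_mat n n" "x \<in> carrier_vec n"
  shows "quad_form M (of_real c \<cdot>\<^sub>v x) = of_real (c\<^sup>2) * quad_form M x"
  using assms cscalar_smult[of "M *\<^sub>v x" n x "of_real c" "of_real c"]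
  by (simp add: quad_form_def mult_mat_vec power2_eq_square)

text \<open>The numerical range sees only unit vectors; a nonzero zero of the form could be rescaled
  to one.\<close>

lemma sectorial_quad_form_nonzero:
  assumes "sectorial M" "M \<in> carrier_mat n n" "x \<in> carrier_vec n" "x \<noteq> 0\<^sub>v n"
  shows "quad_form M x \<noteq> 0"
proof
  assume 0: "quad_form M x = 0"
  obtain c :: real where c: "(of_real c \<cdot>\<^sub>v x) \<bullet>c (of_real c \<cdot>\<^sub>v x) = 1"
    using normalize_cvec[OF assms(3,4)] by metis
  have "quad_form M (of_real c \<cdot>\<^sub>v x) = 0"
    using quad_form_smult[OF assms(2,3)] 0 by simp
  moreover have "of_real c \<cdot>\<^sub>v x \<in> carrier_vec (dim_row M)" using assms by simp
  ultimately have "0 \<in> numerical_range M"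
    using c unfolding numerical_range_def quad_form_def by (metis (mono_tags, lifting) mem_Collect_eq)
  then show False using assms(1) by (simp add: sectorial_def)
qed

text \<open>Elimination rule that also records how the form depends on \<open>x\<close>: only the
  last \<open>r\<close> coordinates of \<open>mat_adjoint U\<close> applied to \<open>x\<close>
  matter, since the zero block contributes 0.\<close>

lemma quasi_sectorial_phasesE:
  assumes "quasi_sectorial_phases C ts" "C \<in> carrier_mat n n"
  obtains r U Cs F where "r \<le> n" "U \<in> carrier_mat n n" "mat_adjoint U * U = 1\<^sub>m n"
    "Cs \<in> carrier_mat r r" "F \<in> carrier_mat n n"
    "F = four_block_mat (0\<^sub>m (n - r) (n - r)) (0\<^sub>m (n - r) r) (0\<^sub>m r (n - r)) Cs"
    "C = U * F * mat_adjoint U" "sectorial_phases Cs ts"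
    "\<And>x. x \<in> carrier_vec n \<Longrightarrow> quad_form C x = quad_form F (mat_adjoint U *\<^sub>v x)"
    "\<And>v w. v \<in> carrier_vec (n - r) \<Longrightarrow> w \<in> carrier_vec r \<Longrightarrow> quad_form F (v @\<^sub>v w) = quad_form Cs w"
proof -
  obtain r U Cs where r: "r \<le> n" and U: "U \<in> carrier_mat n n" and uni: "unitary_mat U"
    and Cs: "Cs \<in> carrier_mat r r"
    and C: "C = U * four_block_mat (0\<^sub>m (n - r) (n - r)) (0\<^sub>m (n - r) r) (0\<^sub>m r (n - r)) Cs * mat_adjoint U"
    and ph: "sectorial_phases Cs ts"
    using assms unfolding quasi_sectorial_phases_def by auto
  define F where "F = four_block_mat (0\<^sub>m (n - r) (n - r)) (0\<^sub>m (n - r) r) (0\<^sub>m r (n - r)) Cs"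
  have F: "F \<in> carrier_mat n n" using Cs r by (auto simp: F_def)
  have 1: "quad_form C x = quad_form F (mat_adjoint U *\<^sub>v x)" if "x \<in> carrier_vec n" for x
    using quad_form_congruence[OF mat_adjoint_carrier[OF U] F that] C by (simp add: F_def)
  have "quad_form (0\<^sub>m (n - r) (n - r)) v = 0" if "v \<in> carrier_vec (n - r)" for v
    using form_in_zero_mat[of "{0}" "n - r"] that by (simp add: form_in_def)
  then have 2: "quad_form F (v @\<^sub>v w) = quad_form Cs w" if "v \<in> carrier_vec (n - r)" "w \<in> carrier_vec r" for v w
    using quad_form_four_block_diag[OF _ Cs that, of "0\<^sub>m (n - r) (n - r)"] that by (simp add: F_def)
  show thesis
    using that[OF r U _ Cs F F_def _ ph 1 2] uni U C by (simp add: unitary_mat_def F_def)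
qed

text \<open>In the coordinates given by \<open>mat_adjoint U\<close> the form of the sectorial block
  vanishes at the last \<open>r\<close> entries \<open>w\<close>, so \<open>w = 0\<close>, and what
  remains is killed by the zero block. Indefinite Hermitian matrices lack this property.\<close>

lemma quasi_sectorial_kernel:
  assumes ph: "quasi_sectorial_phases C ts" and C: "C \<in> carrier_mat n n"
    and y: "y \<in> carrier_vec n" and 0: "quad_form C y = 0"
  shows "C *\<^sub>v y = 0\<^sub>v n"
proof -
  obtain r U Cs F where *: "r \<le> n" "U \<in> carrier_mat n n" "Cs \<in> carrier_mat r r" "F \<in> carrier_mat n n"
    "F = four_block_mat (0\<^sub>m (n - r) (n - r)) (0\<^sub>m (n - r) r) (0\<^sub>m r (n - r)) Cs"
    "C = U * F * mat_adjoint U" "sectorial_phases Cs ts"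
    and qC: "quad_form C y = quad_form F (mat_adjoint U *\<^sub>v y)"
    and qF: "\<And>v w. v \<in> carrier_vec (n - r) \<Longrightarrow> w \<in> carrier_vec r \<Longrightarrow> quad_form F (v @\<^sub>v w) = quad_form Cs w"
    using quasi_sectorial_phasesE[OF ph C] y by metis
  define x where "x = mat_adjoint U *\<^sub>v y"
  define v w where "v = vec_first x (n - r)" and "w = vec_last x r"
  have U': "mat_adjoint U \<in> carrier_mat n n" using * by simp
  have x: "x \<in> carrier_vec (n - r + r)"
    using mult_mat_vec_carrier[OF U' y] *(1) by (simp add: x_def)
  have vw: "x = v @\<^sub>v w" using vec_first_last_append[OF x] by (simp add: v_def w_def)
  have v: "v \<in> carrier_vec (n - r)" and w: "w \<in> carrier_vec r" by (simp_all add: v_def w_def)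
  have "quad_form Cs w = 0" using qC qF[OF v w] 0 vw by (simp add: x_def)
  then have "w = 0\<^sub>v r"
    using sectorial_quad_form_nonzero[OF _ *(3) w] *(7) by (auto simp: sectorial_phases_def)
  then have "F *\<^sub>v x = 0\<^sub>v (n - r) @\<^sub>v 0\<^sub>v r"
    unfolding vw *(5) mult_mat_vec_split[OF zero_carrier_mat *(3) v w]
    using v *(3) by (auto simp: scalar_prod_def intro!: eq_vecI)
  also have "\<dots> = 0\<^sub>v n" using * by (intro eq_vecI) auto
  finally have "F *\<^sub>v x = 0\<^sub>v n" .
  moreover have "C *\<^sub>v y = U *\<^sub>v (F *\<^sub>v x)"
    unfolding *(6) x_def
    using assoc_mult_mat_vec[OF mult_carrier_mat[OF *(2,4)] U' y]
      assoc_mult_mat_vec[OF *(2,4), OF mult_mat_vec_carrier[OF U' y]] by simp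
  ultimately show ?thesis using *(2) by (auto simp: scalar_prod_def intro!: eq_vecI)
qed

text \<open>The witness is supported on the positions of \<open>a\<close> and \<open>b\<close> and
  rests on the identity \<open>sin (b - s) cis a + sin (s - a) cis b = sin (b - a) cis s\<close>.
  Its entries are square roots because the form weights the diagonal by squared moduli.\<close>

lemma cis_diag_attains:
  assumes "a \<in> set ts" "b \<in> set ts" "a \<le> s" "s \<le> b" "b - a < pi"
  obtains w r where "w \<in> carrier_vec (length ts)" "0 < r" "quad_form (cis_diag ts) w = of_real r * cis s"
proof -
  obtain i j where i: "i < length ts" "ts ! i = a" and j: "j < length ts" "ts ! j = b"
    using assms by (meson in_set_conv_nth)
  show thesis
  proof (cases "a = b")
    \<comment> \<open>Here \<open>sin (b - a)\<close> would be 0, so a basis vector is used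
      instead.\<close>
    case True
    define w :: "complex Matrix.vec" where "w = unit_vec (length ts) i"
    have "quad_form (cis_diag ts) w
        = (\<Sum>k<length ts. of_real ((cmod (w $ k))\<^sup>2) * cis (ts ! k))"
      unfolding cis_diag_def by (rule quad_form_mat_diag) (simp add: w_def)
    also have "\<dots> = (\<Sum>k<length ts. if k = i then cis s else 0)"
      using i True assms by (intro sum.cong) (auto simp: w_def)
    finally have "quad_form (cis_diag ts) w = (\<Sum>k<length ts. if k = i then cis s else 0)" .
    then show thesis using that[of w 1] i by (simp add: w_def)
  next
    case False
    then have ij: "i \<noteq> j" using i j by auto
    define p q where "p = sin (b - s)" and "q = sin (s - a)"
    have pq: "0 \<le> p" "0 \<le> q" using assms by (auto simp: p_def q_def intro!: sin_ge_zero)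
    define w :: "complex Matrix.vec" where
      "w = Matrix.vec (length ts) (\<lambda>k. of_real (if k = i then sqrt p else if k = j then sqrt q else 0))"
    have w: "w \<in> carrier_vec (length ts)" by (simp add: w_def)
    have "quad_form (cis_diag ts) w = (\<Sum>k<length ts. (if k = i then of_real p * cis a else 0)
        + (if k = j then of_real q * cis b else 0))"
      unfolding cis_diag_def quad_form_mat_diag[OF w] using i j ij pq
      by (intro sum.cong) (auto simp: w_def simp del: of_real_power)
    also have "\<dots> = of_real p * cis a + of_real q * cis b"
      using i j by (simp add: sum.distrib)
    also have "\<dots> = of_real (sin (b - a)) * cis s"
      by (simp add: complex_eq_iff p_def q_def sin_diff algebra_simps)
    finally have "quad_form (cis_diag ts) w = of_real (sin (b - a)) * cis s" .
    moreover have "0 < sin (b - a)" using assms False by (intro sin_gt_zero) auto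
    ultimately show thesis using that w by blast
  qed
qed

text \<open>A vector \<open>w\<close> with the desired value for the diagonal matrix is pulled back
  through the inverse of \<open>T\<close>, padded by zeros, and moved by \<open>U\<close>; forms are
  preserved throughout.\<close>

lemma quasi_sectorial_attains:
  assumes ph: "quasi_sectorial_phases C ts" and C: "C \<in> carrier_mat n n"
    and ab: "a \<in> set ts" "b \<in> set ts" "a \<le> s" "s \<le> b"
  obtains z r where "z \<in> carrier_vec n" "0 < r" "quad_form C z = of_real r * cis s"
proof -
  obtain k U Cs F where k: "k \<le> n" and U: "U \<in> carrier_mat n n" and uni: "mat_adjoint U * U = 1\<^sub>m n"
    and Cs: "Cs \<in> carrier_mat k k" and sp: "sectorial_phases Cs ts"
    and qC: "\<And>x. x \<in> carrier_vec n \<Longrightarrow> quad_form C x = quad_form F (mat_adjoint U *\<^sub>v x)"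
    and qF: "\<And>v w. v \<in> carrier_vec (n - k) \<Longrightarrow> w \<in> carrier_vec k \<Longrightarrow> quad_form F (v @\<^sub>v w) = quad_form Cs w"
    using quasi_sectorial_phasesE[OF ph C] by metis
  have len: "length ts = k" and "b - a < pi"
    using sp ab Cs by (auto simp: sectorial_phases_def)
  then obtain w r where w: "w \<in> carrier_vec k" and r: "0 < r"
    and q: "quad_form (cis_diag ts) w = of_real r * cis s"
    using cis_diag_attains[OF ab] by metis
  obtain T where T: "T \<in> carrier_mat k k" "invertible_mat T" and CT: "Cs = mat_adjoint T * cis_diag ts * T"
    using sp Cs by (auto simp: sectorial_phases_def congruent_mat_def)
  obtain T' where T': "T' \<in> carrier_mat k k" "T * T' = 1\<^sub>m k"
  proof -
    obtain T' where 1: "T * T' = 1\<^sub>m k" and 2: "T' * T = 1\<^sub>m (dim_row T')"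
      \<comment> \<open>The notion of inverse fixes no dimensions for \<open>T'\<close>; the column
        counts of the two products recover them.\<close>
      using T unfolding invertible_mat_def inverts_mat_def by auto
    have "dim_col T' = k" using arg_cong[OF 1, of dim_col] by simp
    moreover have "dim_row T' = k" using arg_cong[OF 2, of dim_col] T by simp
    ultimately show thesis using that 1 by blast
  qed
  define x where "x = 0\<^sub>v (n - k) @\<^sub>v (T' *\<^sub>v w)"
  define z where "z = U *\<^sub>v x"
  have Tw: "T' *\<^sub>v w \<in> carrier_vec k" using T' w by simp
  then have "x \<in> carrier_vec (n - k + k)" unfolding x_def by (intro append_carrier_vec) auto
  then have x: "x \<in> carrier_vec n" using k by simp
  have z: "z \<in> carrier_vec n" using U x by (simp add: z_def)
  have "mat_adjoint U *\<^sub>v z = x"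
    using assoc_mult_mat_vec[OF mat_adjoint_carrier[OF U] U x] uni x by (simp add: z_def)
  then have "quad_form C z = quad_form Cs (T' *\<^sub>v w)"
    using qC[OF z] qF[OF _ Tw, of "0\<^sub>v (n - k)"] by (simp add: x_def)
  also have "\<dots> = quad_form (cis_diag ts) (T *\<^sub>v (T' *\<^sub>v w))"
    unfolding CT using len by (intro quad_form_congruence[OF T(1) _ Tw]) (simp add: cis_diag_def)
  also have "T *\<^sub>v (T' *\<^sub>v w) = w"
    using assoc_mult_mat_vec[OF T(1) T'(1) w] T'(2) w by simp
  finally show thesis using that z r q by simp
qed

section \<open>Rank-one matrices with a single phase\<close>

text \<open>Gram-Schmidt, started at \<open>u\<close> and followed by normalization. The last column
  is prescribed because the nonzero block in the quasi-sectorial decomposition comes last.\<close>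

lemma unitary_with_last_col:
  assumes u: "u \<in> carrier_vec n" and norm: "u \<bullet>c u = 1"
  obtains U where "U \<in> carrier_mat n n" "unitary_mat U" "col U (n - 1) = u" "0 < n"
proof -
  interpret cof_vec_space n "TYPE(complex)" .
  have u0: "u \<noteq> 0\<^sub>v n" using norm u by auto
  then have n: "0 < n" using u by (cases n) auto
  define us where "us = gram_schmidt n (basis_completion u)"
  note bc = basis_completion[OF u u0]
  obtain vs where bv: "basis_completion u = u # vs"
    using bc(6,7) n by (cases "basis_completion u") auto
  note gs = gram_schmidt_result[OF bc(2,4,5) us_def]
  have len: "length us = n" using gs bc by simp
  have "hd us = u" using gram_schmidt_hd[OF u, of vs] by (simp add: us_def bv)
  then have hd: "us ! 0 = u" using len n hd_conv_nth[of us] by fastforce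
  have uc: "us ! i \<in> carrier_vec n" if "i < n" for i using gs(3) len that by auto
  define N :: "complex Matrix.vec \<Rightarrow> real" where "N w = 1 / sqrt (Re (w \<bullet>c w))" for w
  \<comment> \<open>Gram-Schmidt keeps \<open>u\<close> first, so the order is reversed to place it
    at index \<open>n - 1\<close>.\<close>
  define ws where "ws = map (\<lambda>i. of_real (N (us ! (n - 1 - i))) \<cdot>\<^sub>v us ! (n - 1 - i)) [0..<n]"
  define U where "U = mat_of_cols n ws"
  have U: "U \<in> carrier_mat n n" using mat_of_cols_carrier(1)[of n ws] by (simp add: U_def ws_def)
  have col: "col U i = of_real (N (us ! (n - 1 - i))) \<cdot>\<^sub>v us ! (n - 1 - i)" if "i < n" for i
    unfolding U_def using that uc by (subst col_mat_of_cols) (auto simp: ws_def)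
  have orth: "(of_real (N (us ! i)) \<cdot>\<^sub>v us ! i) \<bullet>c (of_real (N (us ! j)) \<cdot>\<^sub>v us ! j) = (if i = j then 1 else 0)"
    if ij: "i < n" "j < n" for i j
  proof -
    have o: "(us ! i \<bullet>c us ! j = 0) = (i \<noteq> j)"
      using corthogonalD[OF gs(2)] ij len by simp
    show ?thesis
    proof (cases "i = j")
      case True
      then have "us ! i \<noteq> 0\<^sub>v n" using o uc[OF ij(1)] by auto
      then obtain \<rho> where \<rho>: "0 < \<rho>" "us ! i \<bullet>c us ! i = complex_of_real \<rho>"
        using cscalar_square_pos[OF uc[OF ij(1)]] by metis
      have "N (us ! i) * N (us ! i) * \<rho> = 1" using \<rho> by (simp add: N_def)
      then have "complex_of_real (N (us ! i)) * of_real (N (us ! i)) * of_real \<rho> = 1"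
        by (metis of_real_1 of_real_mult)
      then show ?thesis using True \<rho> unfolding cscalar_smult[OF uc[OF ij(1)] uc[OF ij(2)]] by simp
    next
      case False
      then show ?thesis using o unfolding cscalar_smult[OF uc[OF ij(1)] uc[OF ij(2)]] by simp
    qed
  qed
  have "mat_adjoint U * U = 1\<^sub>m n"
  proof (rule eq_matI)
    fix i j assume ij: "i < dim_row (1\<^sub>m n :: complex mat)" "j < dim_col (1\<^sub>m n :: complex mat)"
    then have "(mat_adjoint U * U) $$ (i, j) = col U j \<bullet>c col U i"
      using U by (auto simp: scalar_prod_def mult.commute intro!: sum.cong)
    also have "\<dots> = (1\<^sub>m n :: complex mat) $$ (i, j)"
      using ij col orth[of "n - 1 - j" "n - 1 - i"] by auto
    finally show "(mat_adjoint U * U) $$ (i, j) = (1\<^sub>m n :: complex mat) $$ (i, j)" .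
  qed (use U in auto)
  then have "unitary_mat U" using U by (simp add: unitary_mat_def)
  moreover have "col U (n - 1) = u" using col[of "n - 1"] n hd norm u by (simp add: N_def)
  ultimately show thesis using that U n by blast
qed

text \<open>Two opposite nonzero points cannot lie on one ray, so the range contains no line and the
  first case of \<open>field_angle\<close> applies. There the degenerate sector of opening 0
  competes in the infimum.\<close>

lemma field_angle_single_ray:
  assumes "angular_numerical_range C \<subseteq> closed_sector t t"
  shows "field_angle C \<le> 0"
proof -
  have "\<not> L \<subseteq> closed_sector t t" if "line_through_origin L" for L
  proof
    assume L: "L \<subseteq> closed_sector t t"
    obtain z where z: "z \<noteq> 0" "L = range (\<lambda>t::real. of_real t * z)"
      using \<open>line_through_origin L\<close> unfolding line_through_origin_def by (elim exE conjE)
    have ray: "\<exists>p. 0 \<le> p \<and> w = of_real p * cis t" if w: "w \<in> L" for w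
    proof -
      obtain r t' where "w = of_real r * cis t'" "0 \<le> r" "t \<le> t'" "t' \<le> t"
        using subsetD[OF L w] unfolding closed_sector_def mem_Collect_eq by (elim exE conjE)
      then show ?thesis using antisym[of t t'] by auto
    qed
    have "of_real 1 * z \<in> L" "of_real (- 1) * z \<in> L" unfolding z(2) by (rule rangeI)+
    then obtain p q where p: "0 \<le> p" "of_real 1 * z = of_real p * cis t"
      and q: "0 \<le> q" "of_real (- 1) * z = of_real q * cis t"
      using ray by meson
    have "of_real (p + q) * cis t = of_real 1 * z + of_real (- 1) * z"
      unfolding p(2) q(2) by (simp add: distrib_right)
    then have "of_real (p + q) * cis t = 0" by simp
    then have "complex_of_real (p + q) = 0" by (simp del: of_real_add)
    then have "p + q = 0" by (simp only: of_real_eq_0_iff)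
    then have "p = 0" using p(1) q(1) by linarith
    then show False using p(2) z(1) by simp
  qed
  then have "\<nexists>L. line_through_origin L \<and> L \<subseteq> angular_numerical_range C"
    using subset_trans[OF _ assms] by blast
  then have "field_angle C = subtended_angle (angular_numerical_range C)"
    unfolding field_angle_def Let_def by (rule if_P)
  also have "\<dots> \<le> t - t"
    unfolding subtended_angle_def
  proof (rule cInf_lower)
    show "t - t \<in> {b - a |a b. a \<le> b \<and> angular_numerical_range C \<subseteq> closed_sector a b}"
      using assms by blast
    \<comment> \<open>A real infimum lies below the members of its set only once a lower bound is
      known.\<close>
    show "bdd_below {b - a |a b. a \<le> b \<and> angular_numerical_range C \<subseteq> closed_sector a b}"
      by (rule bdd_belowI[of _ 0]) auto
  qed
  finally show ?thesis by simp
qed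

text \<open>The outer product \<open>c u u^*\<close>; for a unit vector \<open>u\<close> this is
  \<open>c\<close> times the orthogonal projection onto the line of \<open>u\<close>.\<close>

definition rank_one :: "nat \<Rightarrow> complex \<Rightarrow> complex Matrix.vec \<Rightarrow> complex mat" where
  "rank_one n c u = Matrix.mat n n (\<lambda>(i, j). c * u $ i * cnj (u $ j))"

lemma rank_one_mult_vec:
  assumes "u \<in> carrier_vec n" "y \<in> carrier_vec n"
  shows "rank_one n c u *\<^sub>v y = (c * (y \<bullet>c u)) \<cdot>\<^sub>v u"
  using assms
  by (intro eq_vecI) (auto simp: rank_one_def scalar_prod_def sum_distrib_left sum_distrib_right mult_ac intro!: sum.cong)

text \<open>A unitary with last column \<open>u\<close> diagonalizes the matrix, leaving the 1 by 1
  block \<open>r * cis t\<close>, which is congruent to \<open>cis t\<close> by the scalar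
  \<open>sqrt r\<close>.\<close>

lemma rank_one_quasi_sectorial_phases:
  assumes u: "u \<in> carrier_vec n" and norm: "u \<bullet>c u = 1" and r: "0 < r"
  shows "quasi_sectorial_phases (rank_one n (of_real r * cis t) u) [t]"
proof -
  let ?c = "of_real r * cis t"
  let ?B = "rank_one n ?c u"
  obtain U where U: "U \<in> carrier_mat n n" "unitary_mat U" "col U (n - 1) = u" and n: "0 < n"
    using unitary_with_last_col[OF u norm] .
  define Cs where "Cs = Matrix.mat 1 1 (\<lambda>_. ?c)"
  let ?F = "four_block_mat (0\<^sub>m (n - 1) (n - 1)) (0\<^sub>m (n - 1) 1) (0\<^sub>m 1 (n - 1)) Cs"
  have F: "?F = mat_diag n (\<lambda>i. if i = n - 1 then ?c else 0)"
    using n by (intro eq_matI) (auto simp: Cs_def mat_diag_def four_block_mat_def Let_def)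
  have "?B = U * ?F * mat_adjoint U"
  proof (rule eq_matI)
    fix i j assume "i < dim_row (U * ?F * mat_adjoint U)" "j < dim_col (U * ?F * mat_adjoint U)"
    then have ij: "i < n" "j < n" using U by auto
    have "(U * ?F * mat_adjoint U) $$ (i, j)
        = (\<Sum>k = 0..<n. U $$ (i, k) * (if k = n - 1 then ?c else 0) * cnj (U $$ (j, k)))"
      unfolding F mat_diag_mult_right[OF U(1)] using U(1) ij by (simp add: scalar_prod_def)
    also have "\<dots> = (\<Sum>k = 0..<n. if k = n - 1 then U $$ (i, k) * ?c * cnj (U $$ (j, k)) else 0)"
      by (rule sum.cong) auto
    also have "\<dots> = ?c * U $$ (i, n - 1) * cnj (U $$ (j, n - 1))" using n by simp
    also have "\<dots> = ?B $$ (i, j)"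
      using ij n U(1) by (simp add: rank_one_def U(3)[symmetric])
    finally show "?B $$ (i, j) = (U * ?F * mat_adjoint U) $$ (i, j)" by simp
  qed (use U in \<open>auto simp: rank_one_def\<close>)
  moreover have "sectorial_phases Cs [t]"
    unfolding sectorial_phases_def
  proof (intro conjI)
    show "sectorial Cs"
      unfolding sectorial_def numerical_range_def
    proof
      assume "0 \<in> {(Cs *\<^sub>v x) \<bullet>c x |x. x \<in> carrier_vec (dim_row Cs) \<and> x \<bullet>c x = 1}"
      then obtain x where "x \<in> carrier_vec 1" "x \<bullet>c x = 1" "(Cs *\<^sub>v x) \<bullet>c x = 0"
        by (auto simp: Cs_def)
      then show False using r by (auto simp: Cs_def scalar_prod_def)
    qed
    define T where "T = Matrix.mat 1 1 (\<lambda>_. complex_of_real (sqrt r))"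
    define T' where "T' = Matrix.mat 1 1 (\<lambda>_. complex_of_real (1 / sqrt r))"
    have "T * T' = 1\<^sub>m 1" "T' * T = 1\<^sub>m 1"
      using r by (auto simp: T_def T'_def scalar_prod_def intro!: eq_matI)
    then have "invertible_mat T"
      unfolding invertible_mat_def inverts_mat_def by (auto simp: T_def T'_def)
    moreover have "complex_of_real r = of_real (sqrt r) * of_real (sqrt r)"
      using r by (simp flip: of_real_mult)
    then have "Cs = mat_adjoint T * cis_diag [t] * T"
      by (intro eq_matI) (auto simp: Cs_def T_def cis_diag_def mat_diag_def scalar_prod_def)
    ultimately show "congruent_mat Cs (cis_diag [t])"
      unfolding congruent_mat_def by (auto simp: Cs_def T_def)
  qed (auto simp: Cs_def)
  ultimately show ?thesis
    unfolding quasi_sectorial_phases_def using U n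
    by (intro exI[of _ 1] exI[of _ U] exI[of _ Cs]) (auto simp: rank_one_def Cs_def)
qed

text \<open>The cone of a single phase is a ray, which forces field angle at most 0 and so selects
  the quasi-sectorial case of \<open>has_phases\<close>.\<close>

lemma rank_one_in_phase_class:
  assumes u: "u \<in> carrier_vec n" and norm: "u \<bullet>c u = 1" and r: "0 < r" and t: "\<alpha> \<le> t" "t \<le> \<beta>"
  shows "rank_one n (of_real r * cis t) u \<in> phase_class n \<alpha> \<beta>"
proof -
  let ?B = "rank_one n (of_real r * cis t) u"
  have B: "?B \<in> carrier_mat n n" by (simp add: rank_one_def)
  have ph: "quasi_sectorial_phases ?B [t]"
    by (rule rank_one_quasi_sectorial_phases[OF u norm r])
  have "form_in ?B (phase_cone [t])"
    by (intro quasi_sectorial_phases_form_in[OF B ph] additive_cone_phase_cone) simp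
  moreover have "phase_cone [t] \<subseteq> closed_sector t t"
    unfolding phase_cone_def closed_sector_def by force
  ultimately have "angular_numerical_range ?B \<subseteq> closed_sector t t"
    unfolding angular_numerical_range_def form_in_def quad_form_def by blast
  then have "field_angle ?B \<le> 0" by (rule field_angle_single_ray)
  then have "field_angle ?B < pi" using pi_gt_zero by linarith
  then have "semi_sectorial ?B" "has_phases ?B [t]"
    using ph by (simp_all add: semi_sectorial_def has_phases_def)
  moreover have "{min_phase [t] .. max_phase [t]} \<subseteq> {ereal \<alpha> .. ereal \<beta>}"
    using t by (simp add: min_phase_def max_phase_def)
  ultimately show ?thesis using B unfolding phase_class_def by blast
qed

section \<open>The small phase theorem\<close>

lemma max_phase_eq_Max: "ts \<noteq> [] \<Longrightarrow> max_phase ts = ereal (Max (set ts))"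
  unfolding max_phase_def by (rule Sup_eqI) auto

lemma min_phase_eq_Min: "ts \<noteq> [] \<Longrightarrow> min_phase ts = ereal (Min (set ts))"
  unfolding min_phase_def by (rule Inf_eqI) auto

lemma det_nonzero_if_phase_sums_small:
  assumes A: "A \<in> carrier_mat n n" and B: "B \<in> carrier_mat n n"
    and phA: "quasi_sectorial_phases A as" and coneA: "form_in A (phase_cone as)"
    and coneB: "form_in B (phase_cone bs)"
    and small: "\<And>a b. a \<in> set as \<Longrightarrow> b \<in> set bs \<Longrightarrow> \<bar>a + b + 2 * pi * of_int k\<bar> < pi"
  shows "det (1\<^sub>m n + A * B) \<noteq> 0"
proof
  assume "det (1\<^sub>m n + A * B) = 0"
  moreover have "1\<^sub>m n + A * B \<in> carrier_mat n n" using A B by simp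
  ultimately obtain x where x: "x \<in> carrier_vec n" "x \<noteq> 0\<^sub>v n"
    and 0: "(1\<^sub>m n + A * B) *\<^sub>v x = 0\<^sub>v n"
    using det_0_iff_vec_prod_zero by blast
  define y where "y = B *\<^sub>v x"
  have y: "y \<in> carrier_vec n" using B x by (simp add: y_def)
  have Ay: "A *\<^sub>v y \<in> carrier_vec n" using A y by simp
  have sum0: "x + A *\<^sub>v y = 0\<^sub>v n"
    using 0 x A B unfolding y_def by (simp add: add_mult_distrib_mat_vec[of _ n n])
  have "x $ i + (A *\<^sub>v y) $ i = 0" if "i < n" for i
  proof -
    have "(x + A *\<^sub>v y) $ i = x $ i + (A *\<^sub>v y) $ i"
      by (rule index_add_vec(1)) (use that A in auto)
    then show ?thesis unfolding sum0 using that by simp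
  qed
  then have "A *\<^sub>v y = - x"
    using x A by (intro eq_vecI) (auto simp: eq_neg_iff_add_eq_0 add.commute simp del: index_mult_mat_vec)
  then have "quad_form A y = - (x \<bullet>c y)"
    using x y by (simp add: quad_form_def)
  also have "x \<bullet>c y = cnj (y \<bullet>c x)"
    using x y conjugate_sprod_vec[of y n "conjugate x"] comm_scalar_prod[of x n "conjugate y"]
    by simp
  finally have eq: "quad_form A y = - cnj (quad_form B x)"
    by (simp add: quad_form_def y_def)
  \<comment> \<open>Otherwise \<open>y\<close> would lie in the kernel of \<open>A\<close>, giving
    \<open>x = 0\<close>.\<close>
  have "quad_form A y \<noteq> 0"
    using quasi_sectorial_kernel[OF phA A y] \<open>A *\<^sub>v y = - x\<close> x by (auto simp: uminus_zero_vec_eq)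
  moreover have "quad_form A y \<in> phase_cone as"
    using coneA A y by (auto simp: form_in_def)
  ultimately obtain p s a1 a2 where s: "quad_form A y = of_real p * cis s" "0 < p"
    "a1 \<in> set as" "a2 \<in> set as" "a1 \<le> s" "s \<le> a2"
    unfolding phase_cone_def by (auto simp: less_le)
  have "quad_form B x \<noteq> 0" using eq \<open>quad_form A y \<noteq> 0\<close> by auto
  moreover have "quad_form B x \<in> phase_cone bs"
    using coneB B x by (auto simp: form_in_def)
  ultimately obtain q t b1 b2 where t: "quad_form B x = of_real q * cis t" "0 < q"
    "b1 \<in> set bs" "b2 \<in> set bs" "b1 \<le> t" "t \<le> b2"
    unfolding phase_cone_def by (auto simp: less_le)
  \<comment> \<open>The sum \<open>s + t\<close> lies between \<open>a1 + b1\<close> and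
    \<open>a2 + b2\<close>, so \<open>small\<close> places \<open>u\<close> in the open interval
    from \<open>- pi\<close> to \<open>pi\<close>, where the sine vanishes only at 0. But
    \<open>p * cis u\<close> is the negative number \<open>- q\<close>.\<close>
  define u where "u = s + t + 2 * pi * of_int k"
  have u: "- pi < u" "u < pi"
    using small[OF s(3) t(3)] small[OF s(4) t(4)] s t by (auto simp: u_def abs_less_iff)
  have "cis u = cis s * cis t" by (simp add: u_def cis_mult[symmetric] cis_multiple_2pi)
  then have "of_real p * cis u = (of_real p * cis s) * cis t" by simp
  also have "\<dots> = - (of_real q * (cis (- t) * cis t))"
    using eq unfolding s(1) t(1) by (simp add: cis_cnj)
  also have "\<dots> = - of_real q" by (simp add: cis_mult)
  finally have pq: "of_real p * cis u = - complex_of_real q" .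
  have "p * cos u = - q" "p * sin u = 0"
    using arg_cong[OF pq, of Re] arg_cong[OF pq, of Im] by simp_all
  then have "sin u = 0" using s(2) by simp
  then have "u = 0"
    using u sin_gt_zero[of u] sin_gt_zero[of "- u"] by (cases u "0 :: real" rule: linorder_cases) auto
  then show False using \<open>p * cos u = - q\<close> s(2) t(2) by simp
qed

text \<open>The kernel vector is \<open>A u\<close>: the rank-one matrix sends it to
  \<open>c (u^* A u) u = - u\<close>, and it is nonzero because the form of \<open>A\<close> at
  \<open>u\<close> is.\<close>

lemma det_zero_rank_one:
  assumes A: "A \<in> carrier_mat n n" and u: "u \<in> carrier_vec n"
    and c: "c * quad_form A u = - 1"
  shows "det (1\<^sub>m n + A * rank_one n c u) = 0"
proof -
  let ?B = "rank_one n c u"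
  have B: "?B \<in> carrier_mat n n" by (simp add: rank_one_def)
  have Au: "A *\<^sub>v u \<in> carrier_vec n" using A u by simp
  have "A * ?B *\<^sub>v (A *\<^sub>v u) = A *\<^sub>v (?B *\<^sub>v (A *\<^sub>v u))"
    using assoc_mult_mat_vec[OF A B Au] .
  also have "?B *\<^sub>v (A *\<^sub>v u) = (- 1) \<cdot>\<^sub>v u"
    using rank_one_mult_vec[OF u Au] c by (simp add: quad_form_def)
  also have "A *\<^sub>v ((- 1) \<cdot>\<^sub>v u) = (- 1) \<cdot>\<^sub>v (A *\<^sub>v u)"
    using A u by (rule mult_mat_vec)
  finally have "(1\<^sub>m n + A * ?B) *\<^sub>v (A *\<^sub>v u) = 0\<^sub>v n"
    using A B Au by (auto simp: add_mult_distrib_mat_vec[of _ n n])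
  moreover have "A *\<^sub>v u \<noteq> 0\<^sub>v n"
    using c u by (auto simp: quad_form_def)
  moreover have "1\<^sub>m n + A * ?B \<in> carrier_mat n n" using A B by simp
  ultimately show ?thesis using det_0_iff_vec_prod_zero Au by blast
qed

text \<open>The shift of \<open>\<alpha>\<close> into a window of length \<open>2 * pi\<close>
  beginning at \<open>- pi - a\<close> either misses the open interval, and then
  \<open>\<alpha>\<close> itself resonates with some \<open>s\<close>, or it falls inside, and then
  the shifted \<open>\<beta>\<close> must reach \<open>pi - b\<close>.\<close>

lemma resonant_phases:
  fixes a b \<alpha> \<beta> :: real
  assumes "a \<le> b" "\<alpha> \<le> \<beta>"
    and none: "\<And>k::int. \<not> (- pi - a < \<alpha> + 2 * pi * of_int k \<and> \<beta> + 2 * pi * of_int k < pi - b)"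
  obtains s t :: real and k :: int where "a \<le> s" "s \<le> b" "\<alpha> \<le> t" "t \<le> \<beta>" "s + t = pi + 2 * pi * of_int k"
proof -
  \<comment> \<open>The least integer whose shift brings \<open>\<alpha>\<close> to at least
    \<open>- pi - a\<close>.\<close>
  define k where "k = \<lceil>(- pi - a - \<alpha>) / (2 * pi)\<rceil>"
  define x where "x = \<alpha> + 2 * pi * of_int k"
  have "(- pi - a - \<alpha>) / (2 * pi) \<le> of_int k" "of_int k < (- pi - a - \<alpha>) / (2 * pi) + 1"
    unfolding k_def by linarith+
  then have x: "- pi - a \<le> x" "x < pi - a"
    by (simp_all add: x_def field_simps)
  consider "x = - pi - a" | "pi - b \<le> x" | "- pi - a < x" "x < pi - b" using x by linarith
  then show thesis
  proof cases
    case 1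
    \<comment> \<open>Here \<open>a + x = - pi = pi - 2 * pi\<close>, which accounts for the extra
      \<open>- 1\<close>.\<close>
    then show thesis using that[of a \<alpha> "- k - 1"] assms by (simp add: x_def algebra_simps)
  next
    case 2
    then show thesis using that[of "pi - x" \<alpha> "- k"] assms x by (simp add: x_def algebra_simps)
  next
    case 3
    then have "pi - b \<le> \<beta> + 2 * pi * of_int k" using none[of k] by (simp add: x_def)
    \<comment> \<open>The chosen \<open>t\<close> is the point of the original interval whose shift
      equals \<open>pi - b\<close>.\<close>
    then show thesis using that[of b "pi - b - 2 * pi * of_int k" "- k"] assms 3
      by (simp add: x_def algebra_simps)
  qed
qed

theorem theorem6p1:
  fixes n :: nat and A :: "complex mat" and \<gamma> \<alpha> \<beta> :: real and phases_A :: "real list"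
  assumes "A \<in> carrier_mat n n"
    and "quasi_sectorial A"
    and "has_phases_with_center A \<gamma> phases_A"
    and "0 \<le> \<beta> - \<alpha>" and "\<beta> - \<alpha> < 2 * pi"
  shows "(\<forall>B \<in> phase_class n \<alpha> \<beta>. det (1\<^sub>m n + A * B) \<noteq> 0) \<longleftrightarrow>
    (\<exists>k::int. {ereal (\<alpha> + 2 * pi * of_int k) .. ereal (\<beta> + 2 * pi * of_int k)}
       \<subseteq> {- ereal pi - min_phase phases_A <..< ereal pi - max_phase phases_A})"
    (is "?L \<longleftrightarrow> ?R")
proof
  have hp: "has_phases A phases_A" and qs: "quasi_sectorial_phases A phases_A"
    using assms(2,3) by (auto simp: has_phases_with_center_def has_phases_def quasi_sectorial_def)
  have \<alpha>\<beta>: "\<alpha> \<le> \<beta>" using assms(4) by simp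
  let ?inner = "\<lambda>k::int. {ereal (\<alpha> + 2 * pi * of_int k) .. ereal (\<beta> + 2 * pi * of_int k)}
       \<subseteq> {- ereal pi - min_phase phases_A <..< ereal pi - max_phase phases_A}"
  have inner: "?inner k \<longleftrightarrow> - pi - Min (set phases_A) < \<alpha> + 2 * pi * of_int k \<and>
      \<beta> + 2 * pi * of_int k < pi - Max (set phases_A)" if "phases_A \<noteq> []" for k
  proof -
    \<comment> \<open>A nonempty closed interval lies in an open one exactly when both endpoints
      do.\<close>
    have "{l .. u} \<subseteq> {c <..< d} \<longleftrightarrow> c < l \<and> u < d" if "l \<le> u" for l u c d :: ereal
      using that by (auto intro: less_le_trans le_less_trans)
    then show ?thesis
      unfolding max_phase_eq_Max[OF that] min_phase_eq_Min[OF that] using \<alpha>\<beta> by simp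
  qed
  show ?R if L: ?L
  proof (rule ccontr)
    assume notR: "\<not> ?R"
    have ne: "phases_A \<noteq> []"
    proof
      assume "phases_A = []"
      \<comment> \<open>Without phases the conventions for empty \<open>Inf\<close> and
        \<open>Sup\<close> make the open interval the whole real line.\<close>
      then have "?inner 0"
        by (force simp: max_phase_def min_phase_def top_ereal_def bot_ereal_def less_ereal.simps)
      then show False using notR by blast
    qed
    define a b where "a = Min (set phases_A)" and "b = Max (set phases_A)"
    have ab: "a \<in> set phases_A" "b \<in> set phases_A" "a \<le> b" using ne by (auto simp: a_def b_def)
    obtain s t and k :: int where s: "a \<le> s" "s \<le> b" and t: "\<alpha> \<le> t" "t \<le> \<beta>"
      and st: "s + t = pi + 2 * pi * of_int k"
      using resonant_phases[OF ab(3) \<alpha>\<beta>] notR inner[OF ne] unfolding a_def b_def by metis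
    obtain z r where z: "z \<in> carrier_vec n" and r: "0 < r" and qz: "quad_form A z = of_real r * cis s"
      using quasi_sectorial_attains[OF qs assms(1) ab(1,2) s] .
    have "z \<noteq> 0\<^sub>v n" using qz r assms(1) by (auto simp: quad_form_def)
    then obtain c :: real where c: "0 < c" "(of_real c \<cdot>\<^sub>v z) \<bullet>c (of_real c \<cdot>\<^sub>v z) = 1"
      using normalize_cvec[OF z] by metis
    define u where "u = of_real c \<cdot>\<^sub>v z"
    \<comment> \<open>The modulus of the form of \<open>A\<close> at the unit vector
      \<open>u\<close>; the factor \<open>1 / \<rho>\<close> below cancels it and leaves
      \<open>cis (s + t) = - 1\<close>.\<close>
    define \<rho> where "\<rho> = c\<^sup>2 * r"
    have u: "u \<in> carrier_vec n" "u \<bullet>c u = 1" using z c by (simp_all add: u_def)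
    have \<rho>: "0 < \<rho>" using c r by (simp add: \<rho>_def)
    have "quad_form A u = of_real \<rho> * cis s"
      using quad_form_smult[OF assms(1) z] qz by (simp add: u_def \<rho>_def)
    then have "(of_real (1 / \<rho>) * cis t) * quad_form A u = cis (s + t)"
      using \<rho> by (simp add: cis_mult[symmetric])
    also have "\<dots> = - 1"
      unfolding st by (simp add: cis_mult[symmetric] cis_multiple_2pi)
    finally have "det (1\<^sub>m n + A * rank_one n (of_real (1 / \<rho>) * cis t) u) = 0"
      by (rule det_zero_rank_one[OF assms(1) u(1)])
    moreover have "rank_one n (of_real (1 / \<rho>) * cis t) u \<in> phase_class n \<alpha> \<beta>"
      using \<rho> by (intro rank_one_in_phase_class u t) simp
    ultimately show False using L by blast
  qed
  show ?L if R: ?R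
  proof
    fix B assume "B \<in> phase_class n \<alpha> \<beta>"
    then obtain ts where B: "B \<in> carrier_mat n n" and ts: "has_phases B ts"
      and sub: "{min_phase ts .. max_phase ts} \<subseteq> {ereal \<alpha> .. ereal \<beta>}"
      unfolding phase_class_def by blast
    obtain k where k: "?inner k" using R by blast
    show "det (1\<^sub>m n + A * B) \<noteq> 0"
    proof (rule det_nonzero_if_phase_sums_small[OF assms(1) B qs])
      show "form_in A (phase_cone phases_A)" by (rule has_phases_form_in[OF assms(1) hp])
      show "form_in B (phase_cone ts)" by (rule has_phases_form_in[OF B ts])
      fix a b assume a: "a \<in> set phases_A" and b: "b \<in> set ts"
      \<comment> \<open>A given phase of \<open>A\<close> makes the extreme phases real; if either
        list is empty the condition on sums is vacuous.\<close>
      have "phases_A \<noteq> []" using a by auto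
      then have "- pi - Min (set phases_A) < \<alpha> + 2 * pi * of_int k"
        "\<beta> + 2 * pi * of_int k < pi - Max (set phases_A)" using k inner by blast+
      moreover have "Min (set phases_A) \<le> a" "a \<le> Max (set phases_A)" using a by auto
      moreover have "ereal b \<in> {min_phase ts .. max_phase ts}"
        using b by (auto simp: min_phase_def max_phase_def intro: Inf_lower Sup_upper)
      then have "ereal b \<in> {ereal \<alpha> .. ereal \<beta>}" using sub by blast
      then have "\<alpha> \<le> b" "b \<le> \<beta>" by auto
      ultimately show "\<bar>a + b + 2 * pi * of_int k\<bar> < pi" by (simp add: abs_less_iff)
    qed
  qed
qed

end
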